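(* Let $I\subseteq\mathbb{R}$ be an interval with interior $I^{\circ}$, let $f:I\to\mathbb{R}$ be differentiable on $I^{\circ}$, let $a,b\in I^{\circ}$ with $0\le a<b$, and suppose $f'\in L[a,b]$. Let $\alpha>0$. If $|f'|$ is convex on $[a,b]$ and $g:[a,b]\to\mathbb{R}$ is continuous and symmetric to $(a+b)/2$, then $$\left|\left(\frac{f(a)+f(b)}{2}\right)\left[J_{a+}^{\alpha}g(b)+J_{b-}^{\alpha}g(a)\right]-\left[J_{a+}^{\alpha}(fg)(b)+J_{b-}^{\alpha}(fg)(a)\right]\right|\le \frac{(b-a)^{\alpha+1}\|g\|_{\infty}}{(\alpha+1)\Gamma(\alpha+1)}\left(1-\frac{1}{2^{\alpha}}\right)\left[|f'(a)|+|f'(b)|\right].$$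
   Context: $L[a,b]$ denotes the space of Lebesgue integrable functions on $[a,b]$. For $h\in L[a,b]$ and $\alpha>0$, the Riemann-Liouville fractional integrals of order $\alpha$ are $$J_{a+}^{\alpha}h(x)=\frac{1}{\Gamma(\alpha)}\int_a^x (x-t)^{\alpha-1}h(t)\,dt\quad (x>a),\qquad J_{b-}^{\alpha}h(x)=\frac{1}{\Gamma(\alpha)}\int_x^b (t-x)^{\alpha-1}h(t)\,dt\quad (x<b),$$ where $\Gamma(\alpha)=\int_0^\infty e^{-t}t^{\alpha-1}\,dt$. In particular $J_{a+}^{\alpha}h(b)=\frac{1}{\Gamma(\alpha)}\int_a^b (b-t)^{\alpha-1}h(t)\,dt$ and $J_{b-}^{\alpha}h(a)=\frac{1}{\Gamma(\alpha)}\int_a^b (t-a)^{\alpha-1}h(t)\,dt$. "$g$ is symmetric to $(a+b)/2$" means $g(a+b-x)=g(x)$ for all $x\in[a,b]$. $fg$ denotes the pointwise product on $[a,b]$, and $\|g\|_{\infty}=\sup_{x\in[a,b]}|g(x)|$. *)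

theory Defs
  imports "HOL-Analysis.Analysis"
begin

text \<open>
  Riemann--Liouville fractional integrals of order \<open>\<alpha> > 0\<close>. They are only meant for
  \<open>a < x\<close> (left-sided) resp. \<open>x < b\<close> (right-sided) and for \<open>h\<close> Lebesgue integrable on the
  ambient interval. The kernel at \<open>t = x\<close> is \<open>0 powr (\<alpha> - 1) = 0\<close>, which concerns a null set only.
\<close>

definition RL_left :: "real \<Rightarrow> real \<Rightarrow> (real \<Rightarrow> real) \<Rightarrow> real \<Rightarrow> real" where
  "RL_left a \<alpha> h x =
     1 / Gamma \<alpha> * (LINT t:{a..x}|lebesgue. (x - t) powr (\<alpha> - 1) * h t)"

definition RL_right :: "real \<Rightarrow> real \<Rightarrow> (real \<Rightarrow> real) \<Rightarrow> real \<Rightarrow> real" where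
  "RL_right b \<alpha> h x =
     1 / Gamma \<alpha> * (LINT t:{x..b}|lebesgue. (t - x) powr (\<alpha> - 1) * h t)"

end

theory Submission
  imports Defs
begin

text \<open>
  Reflecting \<open>t \<mapsto> a + b - t\<close> moves both kernels to \<open>(t - a) powr (\<alpha> - 1)\<close>, and since \<open>g\<close> is
  symmetric the left-hand side becomes \<open>\<bar>\<integral> F g (t - a) powr (\<alpha> - 1)\<bar> / Gamma \<alpha>\<close> with
  \<open>F t = f a + f b - f t - f (a + b - t)\<close>. This \<open>F\<close> vanishes at both endpoints, and convexity of
  \<open>\<bar>f'\<bar>\<close> gives \<open>\<bar>F' t\<bar> \<le> \<bar>f' t\<bar> + \<bar>f' (a + b - t)\<bar> \<le> \<bar>f' a\<bar> + \<bar>f' b\<bar>\<close>. Hence \<open>\<bar>F t\<bar>\<close> is at most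
  this constant times \<open>min (t - a) (b - t)\<close>, whose integral against the kernel is explicit.
\<close>

lemma has_integral_powr_shift:
  fixes a m \<beta> :: real
  assumes "\<beta> > -1" "a \<le> m"
  shows "((\<lambda>t. (t - a) powr \<beta>) has_integral (m - a) powr (\<beta> + 1) / (\<beta> + 1)) {a..m}"
proof -
  have "((\<lambda>t. (t - a) powr \<beta>) has_integral
      (m - a) powr (\<beta> + 1) / (\<beta> + 1) - (a - a) powr (\<beta> + 1) / (\<beta> + 1)) {a..m}"
  \<comment> \<open>For \<open>\<beta> < 0\<close> the integrand is unbounded near \<open>a\<close>,
    but \<open>\<beta> + 1 > 0\<close> keeps the antiderivative continuous up to \<open>a\<close>.
    So it is differentiated on the open interval only.\<close>
  proof (rule fundamental_theorem_of_calculus_interior)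
    show "continuous_on {a..m} (\<lambda>t. (t - a) powr (\<beta> + 1) / (\<beta> + 1))"
      using assms
      by (intro continuous_on_divide continuous_on_powr' continuous_on_diff
          continuous_on_id continuous_on_const) auto
    fix t assume "t \<in> {a<..<m}"
    then have "((\<lambda>t. (t - a) powr (\<beta> + 1) / (\<beta> + 1)) has_real_derivative (t - a) powr \<beta>)
        (at t)"
      using assms by (auto intro!: derivative_eq_intros)
    then show "((\<lambda>t. (t - a) powr (\<beta> + 1) / (\<beta> + 1)) has_vector_derivative (t - a) powr \<beta>)
        (at t)"
      by (simp add: has_real_derivative_iff_has_vector_derivative)
  qed (use assms in auto)
  then show ?thesis by simp
qed

lemma has_integral_reflect_interval:
  fixes h :: "real \<Rightarrow> real"
  assumes "(h has_integral i) {a..b}"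
  shows "((\<lambda>t. h (a + b - t)) has_integral i) {a..b}"
proof -
  have "((\<lambda>t. h ((-1) *\<^sub>R t + (a + b))) has_integral (1 / \<bar>-1\<bar> ^ DIM(real)) *\<^sub>R i)
      ((\<lambda>t. (1 / (-1)) *\<^sub>R t + - ((1 / (-1)) *\<^sub>R (a + b))) ` cbox a b)"
    by (rule has_integral_affinity) (use assms in auto)
  moreover have "(\<lambda>t. (1 / (-1)) *\<^sub>R t + - ((1 / (-1)) *\<^sub>R (a + b))) ` cbox a b = {a..b}"
  proof -
    have "(\<lambda>t. (1 / (-1)) *\<^sub>R t + - ((1 / (-1)) *\<^sub>R (a + b))) = (-) (a + b)"
      by (auto simp: fun_eq_iff)
    then show ?thesis by simp
  qed
  ultimately show ?thesis by (simp add: algebra_simps)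
qed

text \<open>The kernel is nonnegative with finite integral, hence absolutely integrable, and
  \<open>h\<close> is measurable and bounded as a continuous function on a compact interval.
  Absolute integrability is what lets the Lebesgue integrals in \<open>RL_left\<close> and
  \<open>RL_right\<close> be computed as gauge integrals.\<close>

lemma absolutely_integrable_powr_mult:
  fixes h :: "real \<Rightarrow> real"
  assumes "\<alpha> > 0" "a \<le> b" "continuous_on {a..b} h"
  shows "(\<lambda>t. (t - a) powr (\<alpha> - 1) * h t) absolutely_integrable_on {a..b}"
proof -
  have "(\<lambda>t. (t - a) powr (\<alpha> - 1)) absolutely_integrable_on {a..b}"
    using has_integral_powr_shift[of "\<alpha> - 1" a b] assms
    by (intro nonnegative_absolutely_integrable_1) (auto simp: integrable_on_def)
  moreover have "h \<in> borel_measurable (lebesgue_on {a..b})"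
    by (rule continuous_imp_measurable_on_sets_lebesgue[OF assms(3)]) auto
  moreover have "bounded (h ` {a..b})"
    using assms(3) by (intro compact_imp_bounded compact_continuous_image) auto
  ultimately have "(\<lambda>t. h t * (t - a) powr (\<alpha> - 1)) absolutely_integrable_on {a..b}"
    by (intro absolutely_integrable_bounded_measurable_product_real) auto
  then show ?thesis by (simp add: mult.commute)
qed

lemma integrable_powr_mult:
  fixes h :: "real \<Rightarrow> real"
  assumes "\<alpha> > 0" "a \<le> b" "continuous_on {a..b} h"
  shows "(\<lambda>t. (t - a) powr (\<alpha> - 1) * h t) integrable_on {a..b}"
  using absolutely_integrable_powr_mult[OF assms] by (rule set_lebesgue_integral_eq_integral(1))

lemma RL_right_eq_integral:
  assumes "\<alpha> > 0" "a \<le> b" "continuous_on {a..b} h"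
  shows "RL_right b \<alpha> h a = 1 / Gamma \<alpha> * integral {a..b} (\<lambda>t. (t - a) powr (\<alpha> - 1) * h t)"
  unfolding RL_right_def
  using set_lebesgue_integral_eq_integral(2)[OF absolutely_integrable_powr_mult[OF assms]] by simp

lemma continuous_on_reflect_interval:
  fixes h :: "real \<Rightarrow> real"
  assumes "continuous_on {a..b} h"
  shows "continuous_on {a..b} (\<lambda>t. h (a + b - t))"
  by (rule continuous_on_compose2[OF assms]) (auto intro!: continuous_intros)

text \<open>The kernel of \<open>RL_left\<close> is centred at \<open>b\<close>. Reflecting it to
  \<open>a\<close> lets both fractional integrals share one kernel, with the reflection passed on to
  \<open>h\<close>.\<close>

lemma RL_left_eq_integral:
  assumes "\<alpha> > 0" "a \<le> b" "continuous_on {a..b} h"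
  shows "RL_left a \<alpha> h b
    = 1 / Gamma \<alpha> * integral {a..b} (\<lambda>t. (t - a) powr (\<alpha> - 1) * h (a + b - t))"
proof -
  let ?p = "\<lambda>t. (t - a) powr (\<alpha> - 1) * h (a + b - t)"
  have "?p absolutely_integrable_on {a..b}"
    using assms by (intro absolutely_integrable_powr_mult continuous_on_reflect_interval)
  then have int: "?p integrable_on {a..b}" "(\<lambda>t. \<bar>?p t\<bar>) integrable_on {a..b}"
    by (auto simp: absolutely_integrable_on_def)
  have refl: "?p (a + b - t) = (b - t) powr (\<alpha> - 1) * h t" for t by simp
  have hi: "((\<lambda>t. (b - t) powr (\<alpha> - 1) * h t) has_integral integral {a..b} ?p) {a..b}"
    using has_integral_reflect_interval[OF integrable_integral[OF int(1)]] by simp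
  \<comment> \<open>The reflection lemma concerns gauge integrals, so absolute integrability is
    carried over by reflecting the integral of the absolute value as well.\<close>
  moreover have "(\<lambda>t. \<bar>(b - t) powr (\<alpha> - 1) * h t\<bar>) integrable_on {a..b}"
    using has_integral_reflect_interval[OF integrable_integral[OF int(2)]]
    by (simp add: integrable_on_def) blast
  ultimately have "(\<lambda>t. (b - t) powr (\<alpha> - 1) * h t) absolutely_integrable_on {a..b}"
    by (auto simp: absolutely_integrable_on_def integrable_on_def)
  from set_lebesgue_integral_eq_integral(2)[OF this] show ?thesis
    unfolding RL_left_def using integral_unique[OF hi] by simp
qed

text \<open>The minimum switches branch at the midpoint \<open>m\<close>. Left of it the integrand
  is \<open>(t - a) powr \<alpha>\<close>; right of it, with \<open>L = b - a\<close>, it is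
  \<open>L * (t - a) powr (\<alpha> - 1) - (t - a) powr \<alpha>\<close>, which has the
  antiderivative \<open>P\<close>.\<close>

lemma has_integral_min_powr:
  fixes a b \<alpha> :: real
  assumes "\<alpha> > 0" "a < b"
  shows "((\<lambda>t. (t - a) powr (\<alpha> - 1) * min (t - a) (b - t)) has_integral
    (b - a) powr (\<alpha> + 1) * (1 - 1 / 2 powr \<alpha>) / (\<alpha> * (\<alpha> + 1))) {a..b}"
proof -
  let ?k = "\<lambda>t. (t - a) powr (\<alpha> - 1) * min (t - a) (b - t)"
  define m where "m = (a + b) / 2"
  define L where "L = b - a"
  define P where "P = (\<lambda>t. L * (t - a) powr \<alpha> / \<alpha> - (t - a) powr (\<alpha> + 1) / (\<alpha> + 1))"
  have m: "a < m" "m < b" "m - a = L / 2" using assms by (auto simp: m_def L_def)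
  have L: "L > 0" "b - a = L" using assms by (auto simp: L_def)
  have pow: "(t - a) powr \<alpha> = (t - a) powr (\<alpha> - 1) * (t - a)" if "t > a" for t
    using powr_add[of "t - a" "\<alpha> - 1" 1] that by simp
  have left: "(?k has_integral (L / 2) powr (\<alpha> + 1) / (\<alpha> + 1)) {a..m}"
  proof (rule has_integral_eq)
    show "((\<lambda>t. (t - a) powr \<alpha>) has_integral (L / 2) powr (\<alpha> + 1) / (\<alpha> + 1)) {a..m}"
      using has_integral_powr_shift[of \<alpha> a m] assms m by simp
    fix t assume "t \<in> {a..m}"
    \<comment> \<open>The power law \<open>pow\<close> covers \<open>t > a\<close>. At
      \<open>t = a\<close> both sides are 0: the left because \<open>0 powr \<alpha> = 0\<close>,
      the right because the minimum vanishes.\<close>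
    then show "(t - a) powr \<alpha> = ?k t"
      using pow[of t] by (cases "t = a") (auto simp: m_def min_def)
  qed
  have right: "(?k has_integral P b - P m) {m..b}"
  \<comment> \<open>Here \<open>t \<ge> m > a\<close>, away from the singularity of the kernel, so
    \<open>P\<close> is differentiable on the whole closed interval.\<close>
  proof (rule fundamental_theorem_of_calculus)
    fix t assume t: "t \<in> {m..b}"
    then have "t > a" using m by auto
    have min: "min (t - a) (b - t) = L - (t - a)"
      using t by (auto simp: m_def L_def)
    have "?k t = L * (t - a) powr (\<alpha> - 1) - (t - a) powr \<alpha>"
      unfolding min pow[OF \<open>t > a\<close>] by (simp add: algebra_simps)
    moreover have "(P has_real_derivative L * (t - a) powr (\<alpha> - 1) - (t - a) powr \<alpha>)
        (at t within {m..b})"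
      unfolding P_def using \<open>t > a\<close> assms by (auto intro!: derivative_eq_intros)
    ultimately show "(P has_vector_derivative ?k t) (at t within {m..b})"
      by (simp only: has_real_derivative_iff_has_vector_derivative)
  qed (use m in auto)
  \<comment> \<open>Once every power is written through \<open>Q\<close>, \<open>R\<close> and
    \<open>L\<close>, the sum of the two halves is a rational identity. The factor \<open>R\<close>
    comes from evaluating at half the length, and is the source of
    \<open>1 / 2 powr \<alpha>\<close> in the final bound.\<close>
  define Q where "Q = L powr \<alpha>"
  define R where "R = 1 / 2 powr \<alpha>"
  have vals: "L powr (\<alpha> + 1) = Q * L" "(L / 2) powr \<alpha> = Q * R"
    "(L / 2) powr (\<alpha> + 1) = Q * R * L / 2"
    using L by (auto simp: Q_def R_def powr_add powr_divide)
  have "(L / 2) powr (\<alpha> + 1) / (\<alpha> + 1) + (P b - P m)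
      = L powr (\<alpha> + 1) * (1 - R) / (\<alpha> * (\<alpha> + 1))"
    unfolding P_def m(3) L(2) vals Q_def[symmetric] using assms
    by (simp add: divide_simps) (simp add: algebra_simps)
  with has_integral_combine[OF _ _ left right] m L show ?thesis
    by (simp add: R_def)
qed

text \<open>The points \<open>t\<close> and \<open>a + b - t\<close> are convex combinations of the
  endpoints with weights \<open>1 - u\<close> and \<open>u\<close> interchanged, so in the sum of
  the two convexity inequalities each endpoint value gets total weight 1.\<close>

lemma convex_on_reflect_sum_le:
  fixes \<phi> :: "real \<Rightarrow> real"
  assumes "convex_on {a..b} \<phi>" "a < b" "t \<in> {a..b}"
  shows "\<phi> t + \<phi> (a + b - t) \<le> \<phi> a + \<phi> b"
proof -
  define u where "u = (t - a) / (b - a)"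
  have u: "0 \<le> u" "u \<le> 1" using assms by (auto simp: u_def divide_simps)
  have "u * (b - a) = t - a" using assms by (simp add: u_def)
  then have t: "(1 - u) *\<^sub>R a + u *\<^sub>R b = t" "(1 - u) *\<^sub>R b + u *\<^sub>R a = a + b - t"
    by (simp_all add: algebra_simps)
  have "\<phi> t \<le> (1 - u) * \<phi> a + u * \<phi> b"
    using convex_onD[OF assms(1) u, of a b] t assms by auto
  moreover have "\<phi> (a + b - t) \<le> (1 - u) * \<phi> b + u * \<phi> a"
    using convex_onD[OF assms(1) u, of b a] t assms by auto
  ultimately show ?thesis by (simp add: algebra_simps)
qed

lemma trapezoid_defect_le:
  fixes f :: "real \<Rightarrow> real"
  assumes diff: "\<And>x. x \<in> {a..b} \<Longrightarrow> (f has_real_derivative f' x) (at x)"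
    and conv: "convex_on {a..b} (\<lambda>x. \<bar>f' x\<bar>)" and "a < b" and t: "t \<in> {a..b}"
  shows "\<bar>f a + f b - f t - f (a + b - t)\<bar> \<le> (\<bar>f' a\<bar> + \<bar>f' b\<bar>) * min (t - a) (b - t)"
proof -
  define F where "F = (\<lambda>t. f a + f b - f t - f (a + b - t))"
  have dF: "(F has_real_derivative f' (a + b - x) - f' x) (at x within {a..b})"
    if "x \<in> {a..b}" for x
  proof -
    have "(f has_real_derivative f' (a + b - x)) (at (a + b - x))"
      using that by (intro diff) auto
    then have "((\<lambda>x. f (a + b - x)) has_real_derivative f' (a + b - x) * (-1)) (at x)"
      by (rule DERIV_chain2) (auto intro!: derivative_eq_intros)
    with diff[OF that] have "(F has_real_derivative f' (a + b - x) - f' x) (at x)"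
      unfolding F_def by (auto intro!: derivative_eq_intros)
    then show ?thesis by (rule has_field_derivative_at_within)
  qed
  have lip: "\<bar>F y - F x\<bar> \<le> (\<bar>f' a\<bar> + \<bar>f' b\<bar>) * \<bar>y - x\<bar>" if "x \<in> {a..b}" "y \<in> {a..b}" for x y
  proof -
    have "norm (F y - F x) \<le> (\<bar>f' a\<bar> + \<bar>f' b\<bar>) * norm (y - x)"
    proof (rule field_differentiable_bound)
      fix z assume "z \<in> {a..b}"
      then show "norm (f' (a + b - z) - f' z) \<le> \<bar>f' a\<bar> + \<bar>f' b\<bar>"
        using convex_on_reflect_sum_le[OF conv \<open>a < b\<close>, of z] by auto
    qed (use dF that in auto)
    then show ?thesis by simp
  qed
  \<comment> \<open>The Lipschitz bound \<open>lip\<close> is used from both endpoints: starting at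
    \<open>a\<close> it gives the factor \<open>t - a\<close>, starting at \<open>b\<close> the
    factor \<open>b - t\<close>.\<close>
  have "F a = 0" "F b = 0" by (auto simp: F_def)
  then have "\<bar>F t\<bar> \<le> (\<bar>f' a\<bar> + \<bar>f' b\<bar>) * min (t - a) (b - t)"
    using lip[of a t] lip[of b t] t \<open>a < b\<close> by (auto simp: min_def)
  then show ?thesis by (simp only: F_def)
qed

theorem theorem5:
  fixes I :: "real set" and f g :: "real \<Rightarrow> real" and a b \<alpha> :: real
  assumes "is_interval I"
    and "f differentiable_on interior I"
    and "a \<in> interior I" and "b \<in> interior I"
    and "0 \<le> a" and "a < b"
    and "deriv f absolutely_integrable_on {a..b}"
    and "\<alpha> > 0"
    and "convex_on {a..b} (\<lambda>x. \<bar>deriv f x\<bar>)"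
    and "continuous_on {a..b} g"
    and "\<forall>x\<in>{a..b}. g (a + b - x) = g x"
  shows "\<bar>((f a + f b) / 2) * (RL_left a \<alpha> g b + RL_right b \<alpha> g a)
           - (RL_left a \<alpha> (\<lambda>x. f x * g x) b + RL_right b \<alpha> (\<lambda>x. f x * g x) a)\<bar>
         \<le> ((b - a) powr (\<alpha> + 1) * (SUP x\<in>{a..b}. \<bar>g x\<bar>)) / ((\<alpha> + 1) * Gamma (\<alpha> + 1))
            * (1 - 1 / 2 powr \<alpha>) * (\<bar>deriv f a\<bar> + \<bar>deriv f b\<bar>)"
proof -
  note \<alpha> = \<open>\<alpha> > 0\<close> and ab = \<open>a < b\<close> and contg = assms(10)
  define M where "M = \<bar>deriv f a\<bar> + \<bar>deriv f b\<bar>"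
  define N where "N = (SUP x\<in>{a..b}. \<bar>g x\<bar>)"
  define k where "k t = (t - a) powr (\<alpha> - 1)" for t
  define F where "F = (\<lambda>t. f a + f b - f t - f (a + b - t))"
  define K where "K = (b - a) powr (\<alpha> + 1) * (1 - 1 / 2 powr \<alpha>) / (\<alpha> * (\<alpha> + 1))"
  \<comment> \<open>Convexity puts all of \<open>{a..b}\<close> inside the open set
    \<open>interior I\<close>, so \<open>f\<close> has a two-sided derivative even at
    \<open>a\<close> and \<open>b\<close>, and \<open>deriv f\<close> denotes it at every point used
    below.\<close>
  have "convex (interior I)"
    using assms(1) by (simp add: is_interval_convex convex_interior)
  then have "closed_segment a b \<subseteq> interior I"
    using assms(3,4) by (rule closed_segment_subset[rotated 2])
  then have sub: "{a..b} \<subseteq> interior I"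
    using ab by (simp add: closed_segment_eq_real_ivl)
  have df: "(f has_real_derivative deriv f x) (at x)" if "x \<in> {a..b}" for x
  proof -
    have "f differentiable at x"
      using assms(2) sub that by (auto simp: differentiable_on_eq_differentiable_at)
    then show ?thesis
      by (simp add: DERIV_deriv_iff_real_differentiable)
  qed
  have contf: "continuous_on {a..b} f"
    by (rule DERIV_continuous_on, rule has_field_derivative_at_within, rule df)
  have contfg: "continuous_on {a..b} (\<lambda>x. f x * g x)"
    by (intro continuous_intros contf contg)
  have contF: "continuous_on {a..b} F"
    unfolding F_def by (intro continuous_intros contf continuous_on_reflect_interval)
  \<comment> \<open>Compactness of the image makes it bounded above, so the \<open>SUP\<close> in
    \<open>N\<close> is a genuine supremum and dominates each value.\<close>
  have "compact ((\<lambda>x. \<bar>g x\<bar>) ` {a..b})"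
    using contg by (intro compact_continuous_image continuous_on_rabs) auto
  then have gN: "\<bar>g x\<bar> \<le> N" if "x \<in> {a..b}" for x
    unfolding N_def using that
    by (intro cSUP_upper bounded_imp_bdd_above compact_imp_bounded)
  note int = integrable_powr_mult[OF \<alpha> less_imp_le[OF ab], folded k_def]
  note RL = RL_left_eq_integral[OF \<alpha> less_imp_le[OF ab], folded k_def]
    RL_right_eq_integral[OF \<alpha> less_imp_le[OF ab], folded k_def]
  have Gam: "Gamma \<alpha> > 0" using \<alpha> by (rule Gamma_real_pos)
  \<comment> \<open>By symmetry the left and right fractional integrals of \<open>g\<close>
    coincide; their sum is twice one of them, which cancels the 2 in
    \<open>(f a + f b) / 2\<close>.\<close>
  have gs: "integral {a..b} (\<lambda>t. k t * g (a + b - t)) = integral {a..b} (\<lambda>t. k t * g t)"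
    using assms(11) by (intro integral_cong) auto
  \<comment> \<open>Symmetry turns \<open>f (a + b - t) * g t\<close> into the reflected product
    \<open>f (a + b - t) * g (a + b - t)\<close>, the integrand that \<open>RL_left\<close> yields
    for \<open>f x * g x\<close>.\<close>
  have "integral {a..b} (\<lambda>t. k t * (F t * g t))
      = integral {a..b} (\<lambda>t. (f a + f b) * (k t * g t)
          - (k t * (f (a + b - t) * g (a + b - t)) + k t * (f t * g t)))"
    using assms(11) by (intro integral_cong) (auto simp: F_def algebra_simps)
  also have "\<dots> = (f a + f b) * integral {a..b} (\<lambda>t. k t * g t)
      - (integral {a..b} (\<lambda>t. k t * (f (a + b - t) * g (a + b - t)))
         + integral {a..b} (\<lambda>t. k t * (f t * g t)))"
    by (intro integral_unique has_integral_diff has_integral_add has_integral_mult_right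
        integrable_integral int[OF contg] int[OF contfg]
        int[OF continuous_on_reflect_interval[OF contfg]])
  finally have int_F: "integral {a..b} (\<lambda>t. k t * (F t * g t)) =
      (f a + f b) * integral {a..b} (\<lambda>t. k t * g t)
      - (integral {a..b} (\<lambda>t. k t * (f (a + b - t) * g (a + b - t)))
         + integral {a..b} (\<lambda>t. k t * (f t * g t)))" .
  have eq: "(f a + f b) / 2 * (RL_left a \<alpha> g b + RL_right b \<alpha> g a)
      - (RL_left a \<alpha> (\<lambda>x. f x * g x) b + RL_right b \<alpha> (\<lambda>x. f x * g x) a)
      = 1 / Gamma \<alpha> * integral {a..b} (\<lambda>t. k t * (F t * g t))"
    unfolding RL[OF contg] RL[OF contfg] gs int_F using Gam by (simp add: field_simps)
  \<comment> \<open>This is the dominating integrand: \<open>M\<close> bounds the slope of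
    \<open>F\<close>, \<open>N\<close> bounds \<open>g\<close>, and \<open>K\<close> is the weighted
    integral of the distance to the nearer endpoint.\<close>
  have minint: "((\<lambda>t. M * N * (k t * min (t - a) (b - t))) has_integral M * N * K) {a..b}"
    using has_integral_min_powr[OF \<alpha> ab] unfolding k_def K_def by (rule has_integral_mult_right)
  have "norm (integral {a..b} (\<lambda>t. k t * (F t * g t)))
      \<le> integral {a..b} (\<lambda>t. M * N * (k t * min (t - a) (b - t)))"
  proof (rule integral_norm_bound_integral)
    show "(\<lambda>t. k t * (F t * g t)) integrable_on {a..b}"
      by (intro int continuous_intros contF contg)
    show "(\<lambda>t. M * N * (k t * min (t - a) (b - t))) integrable_on {a..b}"
      using minint by blast
    fix t assume t: "t \<in> {a..b}"
    have "\<bar>F t\<bar> \<le> M * min (t - a) (b - t)"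
      unfolding F_def M_def using df assms(9) ab t by (rule trapezoid_defect_le)
    then have "\<bar>F t\<bar> * \<bar>g t\<bar> \<le> (M * min (t - a) (b - t)) * N"
      using gN[OF t] by (intro mult_mono) auto
    then have "k t * (\<bar>F t\<bar> * \<bar>g t\<bar>) \<le> k t * ((M * min (t - a) (b - t)) * N)"
      by (rule mult_left_mono) (simp add: k_def)
    then show "norm (k t * (F t * g t)) \<le> M * N * (k t * min (t - a) (b - t))"
      by (simp add: abs_mult k_def mult_ac)
  qed
  also have "\<dots> = M * N * K" using minint by (rule integral_unique)
  finally have "\<bar>1 / Gamma \<alpha> * integral {a..b} (\<lambda>t. k t * (F t * g t))\<bar>
      \<le> 1 / Gamma \<alpha> * (M * N * K)"
    using Gam by (simp add: abs_mult divide_right_mono)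
  also have "\<dots> = (b - a) powr (\<alpha> + 1) * N / ((\<alpha> + 1) * Gamma (\<alpha> + 1)) * (1 - 1 / 2 powr \<alpha>) * M"
  proof -
    \<comment> \<open>The factor \<open>\<alpha>\<close> in the denominator of \<open>K\<close>
      combines with \<open>Gamma \<alpha>\<close> to give the \<open>Gamma (\<alpha> + 1)\<close> of
      the claim.\<close>
    have "Gamma (\<alpha> + 1) = \<alpha> * Gamma \<alpha>"
      using \<alpha> by (intro Gamma_plus1) (auto elim!: nonpos_Ints_cases)
    then show ?thesis by (simp add: K_def mult_ac)
  qed
  finally show ?thesis unfolding eq M_def N_def .
qed

end
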